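(* Let $B=F(b_1,\ldots,b_n)$ be a Ferrers board with $0\le b_1\le\cdots\le b_n$ and $b_n>0$, and let $x$ be a positive integer. Then $$[x]_q^n=\sum_{k=0}^n\overline{\mathbf{RT}}_{n-k}(B,q)\,([x]_q-[F_{b_1}]_q)([x]_q-[F_{b_2}]_q)\cdots([x]_q-[F_{b_k}]_q).$$
   Context: Fibonacci numbers: $F_0=0$, $F_1=1$, $F_m=F_{m-1}+F_{m-2}$. For an integer $m$, $[m]_q=\frac{1-q^m}{1-q}$ (so $[0]_q=0$). For $m\ge1$, $\mathcal{F}_m$ is the set of tilings of a column of height $m$ (levels $1,\dots,m$ from the bottom) by tiles of heights 1 and 2 whose bottom-most tile has height 1; $\mathcal{F}_0=\emptyset$. For $T\in\mathcal{F}_m$, $\mathrm{rank}_m(T)=\sum F_{i-1}$, the sum over all $i$ such that $T$ has a tile of height 2 occupying levels $i-1$ and $i$. A Ferrers board $F(b_1,\dots,b_n)$ has columns $1,\dots,n$ of heights $b_1\le\cdots\le b_n$. For $0\le k\le n$, $\mathcal{NT}_k(B)$ is the set of Fibonacci rook placements with $k$ tilings: a sequence of columns $1\le i_1<\cdots<i_k\le n$ together with, for each $s=1,\dots,k$, a tiling $T_{i_s}\in\mathcal{F}_{e_s}$ where $e_s=b_{i_s-s+1}$ (geometrically, each tiling cancels top cells of the columns to its right so that after $s$ tilings the untiled columns have $b_1,\dots,b_{n-s}$ uncanceled cells from left to right, and the tiling in column $i_s$ fills its $b_{i_s-s+1}$ uncanceled cells). For $k=0$ only the empty placement exists. For such $P$,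 $\overline{W}_{B,q}(P)=q^{\sum_{s=1}^k\mathrm{rank}_{e_s}(T_{i_s})}$ and $\overline{\mathbf{RT}}_k(B,q)=\sum_{P\in\mathcal{NT}_k(B)}\overline{W}_{B,q}(P)$. An empty product equals 1. *)

theory Defs
  imports "HOL-Number_Theory.Fib" "HOL-Library.Disjoint_Sets"
begin

definition qint :: "'a::field \<Rightarrow> int \<Rightarrow> 'a" where
  "qint q m = (1 - q powi m) / (1 - q)"

text \<open>
  A tiling is a set of tiles, a tile being the set of levels it occupies. The condition
  that the bottom-most tile has height 1 makes the set empty for \<open>m = 0\<close>.
\<close>

definition fib_tilings :: "nat \<Rightarrow> nat set set set" where
  "fib_tilings m =
     {T. partition_on {1..m} T \<and> (\<forall>t\<in>T. \<exists>i. t = {i} \<or> t = {i, i + 1}) \<and> {1} \<in> T}"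

definition tiling_rank :: "nat \<Rightarrow> nat set set \<Rightarrow> nat" where
  "tiling_rank m T = (\<Sum>i | i \<in> {2..m} \<and> {i - 1, i} \<in> T. fib (i - 1))"

text \<open>
  The board with columns \<open>1, \<dots>, n\<close> is given by \<open>n\<close> and its column heights \<open>b 1, \<dots>, b n\<close>.
  A placement is the list of its pairs (column, tiling), from left to right. List positions
  start at 0: the \<open>j\<close>-th tiling is \<open>P ! (j - 1)\<close>, and the number \<open>b (i\<^sub>j - j + 1)\<close> of
  uncanceled cells in its column \<open>i\<^sub>j\<close> is \<open>uncanceled b P (j - 1)\<close>. The subtraction never
  truncates, as the columns are strictly increasing and at least 1.
\<close>

definition uncanceled :: "(nat \<Rightarrow> nat) \<Rightarrow> (nat \<times> nat set set) list \<Rightarrow> nat \<Rightarrow> nat" where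
  "uncanceled b P s = b (fst (P ! s) - s)"

definition fib_placements ::
    "nat \<Rightarrow> (nat \<Rightarrow> nat) \<Rightarrow> nat \<Rightarrow> (nat \<times> nat set set) list set" where
  "fib_placements n b k =
     {P. length P = k \<and> sorted_wrt (<) (map fst P) \<and> fst ` set P \<subseteq> {1..n} \<and>
         (\<forall>s<k. snd (P ! s) \<in> fib_tilings (uncanceled b P s))}"

definition placement_weight ::
    "(nat \<Rightarrow> nat) \<Rightarrow> 'a::field \<Rightarrow> (nat \<times> nat set set) list \<Rightarrow> 'a" where
  "placement_weight b q P = q ^ (\<Sum>s<length P. tiling_rank (uncanceled b P s) (snd (P ! s)))"

definition RT_bar :: "nat \<Rightarrow> (nat \<Rightarrow> nat) \<Rightarrow> nat \<Rightarrow> 'a::field \<Rightarrow> 'a" where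
  "RT_bar n b k q = (\<Sum>P\<in>fib_placements n b k. placement_weight b q P)"

end

theory Submission
  imports Defs
begin

text \<open>
  Splitting off the top tile shows that the tilings of a column of height \<open>m\<close>, weighted by
  rank, sum to \<open>[F\<^sub>m]\<^sub>q\<close>. Splitting off a tiling of the last column shows that
  \<open>RT\<^sub>k\<^sub>+\<^sub>1\<close> of \<open>n + 1\<close> columns equals \<open>RT\<^sub>k\<^sub>+\<^sub>1 + [F\<^sub>e]\<^sub>q RT\<^sub>k\<close> of \<open>n\<close> columns, where
  \<open>e = b (n + 1 - k)\<close>. This is the recurrence of the coefficients of \<open>X\<^sup>n\<close> in the Newton
  basis \<open>\<Prod>i\<le>k. (X - f i)\<close>, which comes from writing \<open>X = (X - f (k + 1)) + f (k + 1)\<close>.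
\<close>

section \<open>Tilings of a column and their top tile\<close>

lemma fib_tilings_subset: "T \<in> fib_tilings m \<Longrightarrow> t \<in> T \<Longrightarrow> t \<subseteq> {1..m}"
  by (auto simp: fib_tilings_def partition_on_def)

lemma fib_tilings_0: "fib_tilings 0 = {}"
  by (auto simp: fib_tilings_def partition_on_def)

lemma fib_tilings_1: "fib_tilings (Suc 0) = {{{1}}}"
proof -
  have "T = {{1}}" if T: "T \<in> fib_tilings (Suc 0)" for T
  proof -
    have "t = {1}" if t: "t \<in> T" for t
    proof -
      have "t \<noteq> {}"
        using T t partition_onD3 unfolding fib_tilings_def by blast
      moreover have "t \<subseteq> {1}"
        using fib_tilings_subset[OF T t] by simp
      ultimately show ?thesis by blast
    qed
    moreover have "{1} \<in> T"
      using T by (simp add: fib_tilings_def)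
    ultimately show ?thesis by blast
  qed
  moreover have "{{1}} \<in> fib_tilings (Suc 0)"
    by (auto simp: fib_tilings_def partition_on_def)
  ultimately show ?thesis by blast
qed

text \<open>Here \<open>t\<close> is a top tile whose removal leaves a column of height
  \<open>l\<close>. As \<open>t\<close> is not \<open>{1}\<close>, adding or removing it does not
  affect the condition on the bottom tile.\<close>

lemma fib_tilings_insert_iff:
  assumes "t \<subseteq> {1..m}" "t \<noteq> {}" "t \<noteq> {1}" "\<exists>i. t = {i} \<or> t = {i, i + 1}"
    and "{1..m} - t = {1..l}" "t \<notin> T"
  shows "insert t T \<in> fib_tilings m \<longleftrightarrow> T \<in> fib_tilings l"
proof -
  have "partition_on {1..m} (insert t T) \<longleftrightarrow> partition_on {1..l} T"
  proof (cases "disjnt t (\<Union>T)")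
    case True
    then show ?thesis
      using assms by (simp add: partition_on_insert)
  next
    \<comment> \<open>Both sides fail: \<open>t\<close> and \<open>u\<close> would be distinct
      overlapping blocks, and the blocks of a partition of \<open>{1..l}\<close> would all avoid
      \<open>t\<close>.\<close>
    case False
    then obtain u where "u \<in> T" "t \<inter> u \<noteq> {}"
      by (auto simp: disjnt_def)
    then have "\<not> partition_on {1..m} (insert t T)"
      using assms(6) disjointD[of "insert t T" t u] by (auto dest!: partition_onD2)
    moreover have "\<not> partition_on {1..l} T"
      using False assms(5) by (auto simp: partition_on_def disjnt_def)
    ultimately show ?thesis by simp
  qed
  then show ?thesis
    using assms(3,4) by (simp add: fib_tilings_def)
qed

lemma insert_single_tile_iff:
  assumes "{Suc (Suc m)} \<notin> T"
  shows "insert {Suc (Suc m)} T \<in> fib_tilings (Suc (Suc m)) \<longleftrightarrow> T \<in> fib_tilings (Suc m)"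
  by (rule fib_tilings_insert_iff) (use assms in auto)

text \<open>At \<open>m = 0\<close> both sides are false: a double tile on levels 1 and 2 would
  overlap the required bottom tile \<open>{1}\<close>.\<close>

lemma insert_double_tile_iff:
  assumes "{Suc m, Suc (Suc m)} \<notin> T"
  shows "insert {Suc m, Suc (Suc m)} T \<in> fib_tilings (Suc (Suc m)) \<longleftrightarrow> T \<in> fib_tilings m"
  by (rule fib_tilings_insert_iff) (use assms in auto)

lemma fib_tilings_Suc_Suc:
  "fib_tilings (Suc (Suc m)) =
     insert {Suc (Suc m)} ` fib_tilings (Suc m) \<union> insert {Suc m, Suc (Suc m)} ` fib_tilings m"
  (is "?A = ?B \<union> ?C")
proof
  show "?A \<subseteq> ?B \<union> ?C"
  proof
    fix T assume T: "T \<in> ?A"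
    then have "Suc (Suc m) \<in> \<Union>T"
      by (simp add: fib_tilings_def partition_on_def)
    then obtain t where t: "t \<in> T" "Suc (Suc m) \<in> t" by blast
    have sub: "t \<subseteq> {1..Suc (Suc m)}" using fib_tilings_subset[OF T t(1)] .
    obtain i where "t = {i} \<or> t = {i, i + 1}"
      using T t(1) by (auto simp: fib_tilings_def)
    \<comment> \<open>The tile \<open>t\<close> holds the top level and cannot stick out above it,
      which leaves one position for each height.\<close>
    then consider "t = {Suc (Suc m)}" | "t = {Suc m, Suc (Suc m)}"
      using t(2) sub by auto
    then have "T - {t} \<in> fib_tilings (Suc m) \<and> t = {Suc (Suc m)} \<or>
        T - {t} \<in> fib_tilings m \<and> t = {Suc m, Suc (Suc m)}"
      using T t(1) insert_single_tile_iff[of m "T - {t}"] insert_double_tile_iff[of m "T - {t}"]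
      by cases (simp_all add: insert_absorb)
    moreover have "T = insert t (T - {t})"
      using t(1) by blast
    ultimately show "T \<in> ?B \<union> ?C" by blast
  qed
  have "{Suc (Suc m)} \<notin> T" if "T \<in> fib_tilings (Suc m)" for T
    using fib_tilings_subset[OF that] by fastforce
  moreover have "{Suc m, Suc (Suc m)} \<notin> T" if "T \<in> fib_tilings m" for T
    using fib_tilings_subset[OF that] by fastforce
  ultimately show "?B \<union> ?C \<subseteq> ?A"
    by (auto simp: insert_single_tile_iff insert_double_tile_iff)
qed

lemma finite_fib_tilings: "finite (fib_tilings m)"
  by (induction m rule: fib.induct) (simp_all add: fib_tilings_0 fib_tilings_1 fib_tilings_Suc_Suc)

section \<open>Generating function of the rank\<close>

lemma tiling_rank_insert_single:
  assumes "T \<in> fib_tilings (Suc m)"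
  shows "tiling_rank (Suc (Suc m)) (insert {Suc (Suc m)} T) = tiling_rank (Suc m) T"
proof -
  have "i \<le> Suc m" if "{i - 1, i} \<in> T" for i
    using fib_tilings_subset[OF assms that] by auto
  moreover have "{i - 1, i} \<noteq> {Suc (Suc m)}" if "i \<ge> 2" for i
    using that by auto
  ultimately have "{i. i \<in> {2..Suc (Suc m)} \<and> {i - 1, i} \<in> insert {Suc (Suc m)} T} =
      {i. i \<in> {2..Suc m} \<and> {i - 1, i} \<in> T}"
    using le_Suc_eq by auto
  then show ?thesis
    by (simp only: tiling_rank_def)
qed

text \<open>The new tile is the term of the rank at \<open>i = Suc (Suc m)\<close>; every other tile
  lies within the levels up to \<open>m\<close>.\<close>

lemma tiling_rank_insert_double:
  assumes "T \<in> fib_tilings m"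
  shows "tiling_rank (Suc (Suc m)) (insert {Suc m, Suc (Suc m)} T) = fib (Suc m) + tiling_rank m T"
proof -
  have le: "i \<le> m" if "{i - 1, i} \<in> T" for i
    using fib_tilings_subset[OF assms that] by auto
  have "{i - 1, i} = {Suc m, Suc (Suc m)} \<longleftrightarrow> i = Suc (Suc m)" for i
    by (auto simp: doubleton_eq_iff)
  then have "{i. i \<in> {2..Suc (Suc m)} \<and> {i - 1, i} \<in> insert {Suc m, Suc (Suc m)} T} =
      insert (Suc (Suc m)) {i. i \<in> {2..m} \<and> {i - 1, i} \<in> T}"
    using le by (auto simp: le_SucI)
  then show ?thesis
    by (simp add: tiling_rank_def)
qed

text \<open>The top-tile recursion matches [a]_q + q^a [b]_q = [a+b]_q with a = F_{m+1} and b = F_m,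
  since a double top tile contributes the factor q^a.\<close>

lemma sum_tiling_rank:
  fixes q :: "'a::field"
  assumes "q \<noteq> 1"
  shows "(\<Sum>T\<in>fib_tilings m. q ^ tiling_rank m T) = qint q (int (fib m))"
proof (induction m rule: fib.induct)
  case 1
  then show ?case by (simp add: fib_tilings_0 qint_def)
next
  case 2
  then show ?case using assms by (simp add: fib_tilings_1 tiling_rank_def qint_def)
next
  case (3 m)
  let ?s = "insert {Suc (Suc m)}" and ?d = "insert {Suc m, Suc (Suc m)}"
  have notin: "{Suc (Suc m)} \<notin> T" "{Suc m, Suc (Suc m)} \<notin> T"
    if "T \<in> fib_tilings m \<or> T \<in> fib_tilings (Suc m)" for T
    using that fib_tilings_subset[of T m "{Suc (Suc m)}"] fib_tilings_subset[of T "Suc m" "{Suc (Suc m)}"]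
      fib_tilings_subset[of T m "{Suc m, Suc (Suc m)}"]
      fib_tilings_subset[of T "Suc m" "{Suc m, Suc (Suc m)}"]
    by auto
  have inj: "inj_on ?s (fib_tilings (Suc m))" "inj_on ?d (fib_tilings m)"
    using notin by (meson inj_onI insert_ident)+
  \<comment> \<open>The two images are told apart by whether the single top tile is present.\<close>
  have disj: "?s ` fib_tilings (Suc m) \<inter> ?d ` fib_tilings m = {}"
  proof -
    have "{Suc (Suc m)} \<notin> ?d T" if "T \<in> fib_tilings m" for T
      using notin(1)[of T] that by (auto simp: doubleton_eq_iff)
    then show ?thesis by blast
  qed
  have "(\<Sum>T\<in>fib_tilings (Suc (Suc m)). q ^ tiling_rank (Suc (Suc m)) T) =
      (\<Sum>T\<in>fib_tilings (Suc m). q ^ tiling_rank (Suc m) T) +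
      q ^ fib (Suc m) * (\<Sum>T\<in>fib_tilings m. q ^ tiling_rank m T)"
    unfolding fib_tilings_Suc_Suc
    by (simp add: sum.union_disjoint disj inj sum.reindex finite_fib_tilings
        tiling_rank_insert_single tiling_rank_insert_double power_add sum_distrib_left)
  also have "\<dots> = qint q (int (fib (Suc m))) + q ^ fib (Suc m) * qint q (int (fib m))"
    by (simp only: 3)
  also have "\<dots> = qint q (int (fib (Suc (Suc m))))"
    using assms by (simp add: qint_def power_int_def nat_add_distrib power_add field_simps)
  finally show ?case .
qed

section \<open>Placements and the recurrence in the number of columns\<close>

lemma fib_placements_0: "fib_placements n b 0 = {[]}"
  by (auto simp: fib_placements_def)

lemma fib_placements_no_columns: "fib_placements 0 b (Suc k) = {}"
  by (auto simp: fib_placements_def)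

text \<open>Strict increase confines the columns of \<open>P\<close> to those before
  \<open>i\<close>. The last tiling has index \<open>k\<close> counted from 0, so it fills
  \<open>b (i - k)\<close> cells.\<close>

lemma fib_placements_snoc_iff:
  "P @ [(i, T)] \<in> fib_placements n b (Suc k) \<longleftrightarrow>
     P \<in> fib_placements (min n (i - 1)) b k \<and> i \<in> {1..n} \<and> T \<in> fib_tilings (b (i - k))"
proof (cases "length P = k")
  case True
  then have "(\<forall>s<Suc k. snd ((P @ [(i, T)]) ! s) \<in> fib_tilings (uncanceled b (P @ [(i, T)]) s)) \<longleftrightarrow>
      (\<forall>s<k. snd (P ! s) \<in> fib_tilings (uncanceled b P s)) \<and> T \<in> fib_tilings (b (i - k))"
    by (auto simp: less_Suc_eq uncanceled_def nth_append)
  moreover have "(\<forall>p\<in>set P. fst p < i) \<and> fst ` set P \<subseteq> {1..n} \<longleftrightarrow> fst ` set P \<subseteq> {1..min n (i - 1)}"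
    by fastforce
  ultimately show ?thesis
    using True by (auto simp: fib_placements_def sorted_wrt_append)
qed (auto simp: fib_placements_def)

lemma fib_placements_Suc_Suc:
  "fib_placements (Suc n) b (Suc k) = fib_placements n b (Suc k) \<union>
     (\<lambda>(P, T). P @ [(Suc n, T)]) ` (fib_placements n b k \<times> fib_tilings (b (Suc n - k)))"
  (is "?A = ?B \<union> ?f ` ?C")
proof (rule set_eqI)
  fix Q
  show "Q \<in> ?A \<longleftrightarrow> Q \<in> ?B \<union> ?f ` ?C"
  proof (cases Q rule: rev_cases)
    case Nil
    then show ?thesis by (auto simp: fib_placements_def)
  next
    case (snoc P p)
    obtain i T where p: "p = (i, T)" by (cases p)
    have "Q \<in> ?f ` ?C \<longleftrightarrow> i = Suc n \<and> P \<in> fib_placements n b k \<and> T \<in> fib_tilings (b (Suc n - k))"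
      by (auto simp: snoc p)
    \<comment> \<open>So allowing column \<open>Suc n\<close> changes only the range of the last
      column \<open>i\<close>, not the condition on \<open>P\<close>.\<close>
    moreover have "i \<in> {1..Suc n} \<Longrightarrow> min (Suc n) (i - 1) = min n (i - 1)"
      by auto
    ultimately show ?thesis
      unfolding snoc p Un_iff fib_placements_snoc_iff
      by (cases "i = Suc n") auto
  qed
qed

lemma finite_fib_placements: "finite (fib_placements n b k)"
proof (induction n arbitrary: k)
  case 0
  then show ?case
    by (cases k) (simp_all add: fib_placements_0 fib_placements_no_columns)
next
  case (Suc n)
  then show ?case
    by (cases k) (simp_all add: fib_placements_0 fib_placements_Suc_Suc finite_fib_tilings)
qed

text \<open>A tiling cancels cells only to its right, so appending one leaves the earlier values of
  \<open>uncanceled\<close> unchanged.\<close>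

lemma placement_weight_snoc:
  "placement_weight b q (P @ [(i, T)]) =
     placement_weight b q P * q ^ tiling_rank (b (i - length P)) T"
proof -
  have "(\<Sum>s<length P. tiling_rank (uncanceled b (P @ [(i, T)]) s) (snd ((P @ [(i, T)]) ! s))) =
      (\<Sum>s<length P. tiling_rank (uncanceled b P s) (snd (P ! s)))"
    by (rule sum.cong) (auto simp: uncanceled_def nth_append)
  then show ?thesis
    by (simp add: placement_weight_def power_add) (simp add: uncanceled_def)
qed

lemma RT_bar_0: "RT_bar n b 0 q = 1"
  by (simp add: RT_bar_def fib_placements_0 placement_weight_def)

lemma RT_bar_Suc_Suc:
  assumes "q \<noteq> 1"
  shows "RT_bar (Suc n) b (Suc k) q =
    RT_bar n b (Suc k) q + qint q (int (fib (b (Suc n - k)))) * RT_bar n b k q"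
proof -
  let ?f = "\<lambda>(P, T). P @ [(Suc n, T)]"
  let ?C = "fib_placements n b k \<times> fib_tilings (b (Suc n - k))"
  have "P @ [(Suc n, T)] \<notin> fib_placements n b (Suc k)" for P T
    by (simp add: fib_placements_snoc_iff)
  then have disj: "fib_placements n b (Suc k) \<inter> ?f ` ?C = {}"
    by auto
  have inj: "inj_on ?f ?C"
    by (auto simp: inj_on_def)
  have "RT_bar (Suc n) b (Suc k) q =
      RT_bar n b (Suc k) q + sum (placement_weight b q) (?f ` ?C)"
    unfolding RT_bar_def fib_placements_Suc_Suc
    by (rule sum.union_disjoint)
      (simp_all only: disj finite_fib_placements finite_fib_tilings finite_imageI finite_cartesian_product)
  also have "sum (placement_weight b q) (?f ` ?C) =
      (\<Sum>(P, T)\<in>?C. placement_weight b q (P @ [(Suc n, T)]))"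
    unfolding sum.reindex[OF inj] by (simp add: comp_def case_prod_unfold)
  also have "(\<Sum>(P, T)\<in>?C. placement_weight b q (P @ [(Suc n, T)])) =
      (\<Sum>(P, T)\<in>?C. placement_weight b q P * q ^ tiling_rank (b (Suc n - k)) T)"
    \<comment> \<open>Membership in \<open>fib_placements n b k\<close> gives
      \<open>length P = k\<close>, so the height is the same for every \<open>P\<close> and the
      double sum factors.\<close>
    by (rule sum.cong) (auto simp: placement_weight_snoc fib_placements_def)
  also have "\<dots> = RT_bar n b k q * (\<Sum>T\<in>fib_tilings (b (Suc n - k)). q ^ tiling_rank (b (Suc n - k)) T)"
    by (simp add: RT_bar_def sum_product sum.cartesian_product)
  finally show ?thesis
    by (simp add: sum_tiling_rank[OF assms] mult.commute)
qed

text \<open>When there are more tilings than columns, both terms of the recurrence vanish by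
  induction.\<close>

lemma RT_bar_eq_0:
  assumes "q \<noteq> 1" "n < k"
  shows "RT_bar n b k q = 0"
  using assms(2)
proof (induction n arbitrary: k)
  case 0
  then show ?case by (cases k) (simp_all add: RT_bar_def fib_placements_no_columns)
next
  case (Suc n)
  then show ?case by (cases k) (simp_all add: RT_bar_Suc_Suc assms(1))
qed

section \<open>Expansion of powers in the Newton basis\<close>

text \<open>The assumptions make \<open>R n (n - k)\<close> the complete homogeneous symmetric
  polynomial of degree n - k in f 1, ..., f (k + 1), for k at most n.\<close>

lemma newton_expansion_power:
  fixes X :: "'a::comm_ring_1" and f :: "nat \<Rightarrow> 'a" and R :: "nat \<Rightarrow> nat \<Rightarrow> 'a"
  assumes R0: "\<And>n. R n 0 = 1"
    and R_rec: "\<And>n k. R (Suc n) (Suc k) = R n (Suc k) + f (Suc n - k) * R n k"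
    and R_zero: "\<And>n. R n (Suc n) = 0"
  shows "X ^ n = (\<Sum>k=0..n. R n (n - k) * (\<Prod>i=1..k. X - f i))"
proof (induction n)
  case 0
  then show ?case by (simp add: R0)
next
  case (Suc n)
  define N where "N k = (\<Prod>i=1..k. X - f i)" for k
  have N_Suc: "X * N k = N (Suc k) + f (Suc k) * N k" for k
    by (simp add: N_def algebra_simps)
  have "X ^ Suc n = (\<Sum>k=0..n. R n (n - k) * (X * N k))"
    by (simp add: Suc.IH N_def sum_distrib_left mult_ac)
  also have "\<dots> = (\<Sum>k=0..n. R n (n - k) * N (Suc k)) + (\<Sum>k=0..n. f (Suc k) * R n (n - k) * N k)"
    by (simp add: N_Suc algebra_simps sum.distrib)
  also have "(\<Sum>k=0..n. R n (n - k) * N (Suc k)) = (\<Sum>k=1..Suc n. R n (Suc n - k) * N k)"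
    by (simp add: sum.shift_bounds_cl_Suc_ivl del: sum.cl_ivl_Suc)
  \<comment> \<open>The added term at \<open>k = 0\<close> has coefficient
    \<open>R n (Suc n)\<close>, which is zero.\<close>
  also have "\<dots> = (\<Sum>k=0..Suc n. R n (Suc n - k) * N k)"
    by (simp add: sum.atLeast_Suc_atMost[of 0] R_zero)
  also have "\<dots> = (\<Sum>k=0..n. R n (Suc n - k) * N k) + N (Suc n)"
    by (simp add: R0)
  also have "\<dots> + (\<Sum>k=0..n. f (Suc k) * R n (n - k) * N k) =
      (\<Sum>k=0..n. (R n (Suc n - k) + f (Suc k) * R n (n - k)) * N k) + N (Suc n)"
    by (simp add: sum.distrib algebra_simps)
  \<comment> \<open>\<open>R_rec\<close> applies with second index \<open>n - k\<close>, and
    \<open>Suc n - (n - k)\<close> is \<open>Suc k\<close> because \<open>k\<close> is at most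
    \<open>n\<close>.\<close>
  also have "(\<Sum>k=0..n. (R n (Suc n - k) + f (Suc k) * R n (n - k)) * N k) =
      (\<Sum>k=0..n. R (Suc n) (Suc n - k) * N k)"
    by (rule sum.cong) (simp_all add: Suc_diff_le R_rec)
  also have "\<dots> + N (Suc n) = (\<Sum>k=0..Suc n. R (Suc n) (Suc n - k) * N k)"
    by (simp add: R0)
  finally show ?case
    by (simp only: N_def)
qed

theorem theorem8:
  fixes q :: "'a::field" and b :: "nat \<Rightarrow> nat" and n :: nat and x :: int
  assumes "q \<noteq> 1"
    and "n \<ge> 1"
    and "mono_on {1..n} b"
    and "b n > 0"
    and "x > 0"
  shows "qint q x ^ n =
    (\<Sum>k=0..n. RT_bar n b (n - k) q * (\<Prod>i=1..k. (qint q x - qint q (int (fib (b i))))))"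
  \<comment> \<open>The Newton nodes are \<open>f i = qint q (int (fib (b i)))\<close>, as read off
    from the recurrence of \<open>RT_bar\<close>.\<close>
  by (rule newton_expansion_power[where R = "\<lambda>n k. RT_bar n b k q"])
    (simp_all add: RT_bar_0 RT_bar_Suc_Suc RT_bar_eq_0 assms(1))

end
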